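(* Let $d_1,\dots,d_l\ge 2$ be natural numbers, let $\lambda>0$ be a real number and let $P_i\in\mathcal{B}(d_i)$, $i=1,\dots,l$, be an arbitrary $l$-tuple. Then, for every $j\in\{1,\dots,l\}$ and any $R_j\in\mathcal{B}(d_j)$, if $P\in\mathcal{B}_{P_1,\dots,P_j,\dots,P_l}(d_1,\dots,d_l)$ and $R\in\mathcal{B}_{P_1,\dots,P_{j-1},R_j,P_{j+1},\dots,P_l}(d_1,\dots,d_l)$, then the Minkowski sum $P+\lambda R$ is a tensorial body. Indeed, $P+\lambda R\in\mathcal{B}_{P_1,\dots,P_{j-1},P_j+\lambda R_j,P_{j+1},\dots,P_l}(d_1,\dots,d_l)$.
   Context: For $d\in\mathbb{N}$, $\mathbb{R}^d$ carries its standard inner product. The tensor product $\otimes_{i=1}^l\mathbb{R}^{d_i}$ carries the inner product $\langle\cdot,\cdot\rangle_H$ determined by $\langle x^1\otimes\cdots\otimes x^l,y^1\otimes\cdots\otimes y^l\rangle_H=\prod_{i=1}^l\langle x^i,y^i\rangle$. A 0-symmetric convex body is a compact convex set $P$ with nonempty interior and $P=-P$; $\mathcal{B}(d)$ is the set of these in $\mathbb{R}^d$. The polar is $P^\circ=\{y:\langle x,y\rangle\le 1\ \forall x\in P\}$ (using $\langle\cdot,\cdot\rangle_H$ in the tensor product). For $P_i\in\mathcal{B}(d_i)$, $i=1,\dots,l$, let $P_1\otimes_\pi\cdots\otimes_\pi P_l:=\mathrm{conv}\{x^1\otimes\cdots\otimes x^l: x^i\in P_i\}$ and $P_1\otimes_\epsilon\cdots\otimes_\epsilon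 P_l:=(P_1^\circ\otimes_\pi\cdots\otimes_\pi P_l^\circ)^\circ$. $\mathcal{B}_{P_1,\dots,P_l}(d_1,\dots,d_l)$ is the set of 0-symmetric convex bodies $P\subset\otimes_{i=1}^l\mathbb{R}^{d_i}$ with $P_1\otimes_\pi\cdots\otimes_\pi P_l\subseteq P\subseteq P_1\otimes_\epsilon\cdots\otimes_\epsilon P_l$. A tensorial body is an element of $\mathcal{B}_{P_1,\dots,P_l}(d_1,\dots,d_l)$ for some $P_i\in\mathcal{B}(d_i)$. *)

theory Defs
  imports "HOL-Analysis.Analysis" "HOL-Library.Function_Algebras"
begin

text \<open>Functions into a real vector space form a real vector space under the pointwise
  operations; addition, zero and negation come from \<^theory>\<open>HOL-Library.Function_Algebras\<close>.\<close>

instantiation "fun" :: (type, real_vector) real_vector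
begin

definition scaleR_fun :: "real \<Rightarrow> ('a \<Rightarrow> 'b) \<Rightarrow> 'a \<Rightarrow> 'b"
  where "scaleR_fun c f = (\<lambda>k. c *\<^sub>R f k)"

instance
  by standard (auto simp: scaleR_fun_def plus_fun_def fun_eq_iff algebra_simps)

end


text \<open>Since the number \<open>l\<close> of factors and the dimensions \<open>d i\<close> vary, finite-dimensional spaces are
  given by their coordinates: for a finite index set \<open>I\<close>, the space \<open>\<real>\<^sup>I\<close> consists of the functions
  vanishing outside \<open>I\<close>. The topology of the function type is the product topology, which induces
  the usual Euclidean topology on \<open>\<real>\<^sup>I\<close>.\<close>

definition coord_space :: "'a set \<Rightarrow> ('a \<Rightarrow> real) set"
  where "coord_space I = {x. \<forall>k. k \<notin> I \<longrightarrow> x k = 0}"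

definition coord_inner :: "'a set \<Rightarrow> ('a \<Rightarrow> real) \<Rightarrow> ('a \<Rightarrow> real) \<Rightarrow> real"
  where "coord_inner I x y = (\<Sum>k\<in>I. x k * y k)"

text \<open>The interior is taken in \<open>\<real>\<^sup>I\<close>, not in the whole function type. Negation is the image
  under \<open>uminus\<close>, as \<open>- P\<close> on sets is the complement.\<close>

definition sym_bodies :: "'a set \<Rightarrow> ('a \<Rightarrow> real) set set"
  where "sym_bodies I =
    {P. P \<subseteq> coord_space I \<and> compact P \<and> convex P \<and>
        (top_of_set (coord_space I)) interior_of P \<noteq> {} \<and> uminus ` P = P}"

definition polar :: "'a set \<Rightarrow> ('a \<Rightarrow> real) set \<Rightarrow> ('a \<Rightarrow> real) set"
  where "polar I P = {y \<in> coord_space I. \<forall>x\<in>P. coord_inner I x y \<le> 1}"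


text \<open>\<open>\<real>\<^sup>d\<close> is the space over the index set \<open>{1..d}\<close>, and \<open>\<real>\<^bsup>d 1\<^esup> \<otimes> \<dots> \<otimes> \<real>\<^bsup>d l\<^esup>\<close> is the space over the
  multi-indices \<open>m\<close> with \<open>m i \<in> {1..d i}\<close> for \<open>i \<in> {1..l}\<close>.\<close>

definition multi_indices :: "nat \<Rightarrow> (nat \<Rightarrow> nat) \<Rightarrow> (nat \<Rightarrow> nat) set"
  where "multi_indices l d = (\<Pi>\<^sub>E i\<in>{1..l}. {1..d i})"

definition elem_tensor ::
    "nat \<Rightarrow> (nat \<Rightarrow> nat) \<Rightarrow> (nat \<Rightarrow> nat \<Rightarrow> real) \<Rightarrow> (nat \<Rightarrow> nat) \<Rightarrow> real"
  where "elem_tensor l d x =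
    (\<lambda>m. if m \<in> multi_indices l d then \<Prod>i\<in>{1..l}. x i (m i) else 0)"

text \<open>The next two lemmas say that \<open>coord_inner (multi_indices l d)\<close> is the inner product on the
  tensor product determined by its values on elementary tensors.\<close>

lemma coord_inner_elem_tensor:
  "coord_inner (multi_indices l d) (elem_tensor l d x) (elem_tensor l d y) =
   (\<Prod>i\<in>{1..l}. coord_inner {1..d i} (x i) (y i))"
proof -
  have "(\<Prod>i\<in>{1..l}. \<Sum>k\<in>{1..d i}. x i k * y i k) =
      (\<Sum>m\<in>multi_indices l d. \<Prod>i\<in>{1..l}. x i (m i) * y i (m i))"
    unfolding multi_indices_def by (rule prod_sum_PiE) auto
  then show ?thesis
    by (simp add: coord_inner_def elem_tensor_def prod.distrib)
qed

lemma span_elem_tensor: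
  "span {elem_tensor l d x |x. \<forall>i\<in>{1..l}. x i \<in> coord_space {1..d i}} =
   coord_space (multi_indices l d)" (is "span ?T = ?V")
proof
  have "subspace ?V"
    by (auto simp: subspace_def coord_space_def plus_fun_def zero_fun_def scaleR_fun_def)
  moreover have "?T \<subseteq> ?V"
    by (auto simp: coord_space_def elem_tensor_def)
  ultimately show "span ?T \<subseteq> ?V"
    by (rule span_minimal[rotated])
next
  have fin: "finite (multi_indices l d)"
    unfolding multi_indices_def by (intro finite_PiE) auto
  define b :: "(nat \<Rightarrow> nat) \<Rightarrow> nat \<Rightarrow> nat \<Rightarrow> real"
    where "b n = (\<lambda>i k. if k = n i then 1 else 0)" for n
  have b: "elem_tensor l d (b n) = (\<lambda>m. if m = n then 1 else 0)"
    if n: "n \<in> multi_indices l d" for n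
  proof
    fix m
    have "\<exists>i\<in>{1..l}. m i \<noteq> n i" if "m \<in> multi_indices l d" "m \<noteq> n"
      using that n PiE_ext unfolding multi_indices_def by metis
    then show "elem_tensor l d (b n) m = (if m = n then 1 else 0)"
      using n by (auto simp: elem_tensor_def b_def prod_zero_iff)
  qed
  have bT: "elem_tensor l d (b n) \<in> ?T" if "n \<in> multi_indices l d" for n
    using that by (fastforce simp: b_def coord_space_def multi_indices_def PiE_iff)
  show "?V \<subseteq> span ?T"
  proof
    fix v assume v: "v \<in> ?V"
    have sum_apply: "(\<Sum>n\<in>A. f n) m = (\<Sum>n\<in>A. f n m)"
      if "finite A" for A :: "(nat \<Rightarrow> nat) set" and f :: "_ \<Rightarrow> (nat \<Rightarrow> nat) \<Rightarrow> real" and m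
      using that by (induction A) (auto simp: plus_fun_def zero_fun_def)
    have "v = (\<Sum>n\<in>multi_indices l d. v n *\<^sub>R elem_tensor l d (b n))"
    proof
      fix m
      have "(\<Sum>n\<in>multi_indices l d. v n *\<^sub>R elem_tensor l d (b n)) m =
          (\<Sum>n\<in>multi_indices l d. if m = n then v n else 0)"
        unfolding sum_apply[OF fin] by (rule sum.cong) (auto simp: b scaleR_fun_def)
      also have "\<dots> = v m"
        using v fin by (auto simp: coord_space_def)
      finally show "v m = (\<Sum>n\<in>multi_indices l d. v n *\<^sub>R elem_tensor l d (b n)) m" ..
    qed
    also have "\<dots> \<in> span ?T"
      using bT by (intro span_sum span_scale span_base)
    finally show "v \<in> span ?T" .
  qed
qed

definition proj_tensor ::
    "nat \<Rightarrow> (nat \<Rightarrow> nat) \<Rightarrow> (nat \<Rightarrow> (nat \<Rightarrow> real) set) \<Rightarrow> ((nat \<Rightarrow> nat) \<Rightarrow> real) set"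
  where "proj_tensor l d P = convex hull {elem_tensor l d x |x. \<forall>i\<in>{1..l}. x i \<in> P i}"

definition inj_tensor ::
    "nat \<Rightarrow> (nat \<Rightarrow> nat) \<Rightarrow> (nat \<Rightarrow> (nat \<Rightarrow> real) set) \<Rightarrow> ((nat \<Rightarrow> nat) \<Rightarrow> real) set"
  where "inj_tensor l d P =
    polar (multi_indices l d) (proj_tensor l d (\<lambda>i. polar {1..d i} (P i)))"

text \<open>The class \<open>\<B>\<^bsub>P 1, \<dots>, P l\<^esub>(d 1, \<dots>, d l)\<close>, which is only defined for \<open>P i \<in> \<B>(d i)\<close>; here it is
  empty for other \<open>P\<close>.\<close>

definition bodies_over ::
    "nat \<Rightarrow> (nat \<Rightarrow> nat) \<Rightarrow> (nat \<Rightarrow> (nat \<Rightarrow> real) set) \<Rightarrow> ((nat \<Rightarrow> nat) \<Rightarrow> real) set set"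
  where "bodies_over l d P =
    {Q \<in> sym_bodies (multi_indices l d).
       (\<forall>i\<in>{1..l}. P i \<in> sym_bodies {1..d i}) \<and>
       proj_tensor l d P \<subseteq> Q \<and> Q \<subseteq> inj_tensor l d P}"

definition tensorial_body ::
    "nat \<Rightarrow> (nat \<Rightarrow> nat) \<Rightarrow> ((nat \<Rightarrow> nat) \<Rightarrow> real) set \<Rightarrow> bool"
  where "tensorial_body l d Q \<longleftrightarrow>
    (\<exists>P. (\<forall>i\<in>{1..l}. P i \<in> sym_bodies {1..d i}) \<and> Q \<in> bodies_over l d P)"

end

theory Submission
  imports Defs
begin

text \<open>The lower inclusion holds because the elementary tensor is additive in its \<open>j\<close>-th argument. For
  the upper inclusion, let \<open>y j\<close> be in the polar of \<open>P j + t R\<^sub>j\<close>, and let \<open>a\<close> and \<open>b\<close> be the values at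
  \<open>y j\<close> of the support functions of \<open>P j\<close> and \<open>R\<^sub>j\<close>, so that \<open>a + t b \<le> 1\<close>. By homogeneity the
  elementary tensor of \<open>y\<close> is at most \<open>a\<close> on \<open>Q\<close> and at most \<open>b\<close> on \<open>R\<close>, hence at most \<open>1\<close> on
  \<open>Q + t R\<close>.\<close>

section \<open>Linear structure, inner product and topology of coordinate spaces\<close>

lemma coord_space_add: "x \<in> coord_space I \<Longrightarrow> y \<in> coord_space I \<Longrightarrow> x + y \<in> coord_space I"
  by (simp add: coord_space_def plus_fun_def)

lemma coord_space_scaleR: "x \<in> coord_space I \<Longrightarrow> c *\<^sub>R x \<in> coord_space I"
  by (simp add: coord_space_def scaleR_fun_def)

lemma coord_space_diff: "x \<in> coord_space I \<Longrightarrow> y \<in> coord_space I \<Longrightarrow> x - y \<in> coord_space I"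
  by (simp add: coord_space_def fun_diff_def)

lemma coord_inner_add_left: "coord_inner I (x + y) z = coord_inner I x z + coord_inner I y z"
  by (simp add: coord_inner_def plus_fun_def algebra_simps sum.distrib)

lemma coord_inner_scaleR_left: "coord_inner I (c *\<^sub>R x) z = c * coord_inner I x z"
  by (simp add: coord_inner_def scaleR_fun_def sum_distrib_left mult.assoc)

lemma coord_inner_commute: "coord_inner I x y = coord_inner I y x"
  by (simp add: coord_inner_def mult.commute)

lemma coord_inner_add_right: "coord_inner I x (y + z) = coord_inner I x y + coord_inner I x z"
  by (metis coord_inner_add_left coord_inner_commute)

lemma coord_inner_scaleR_right: "coord_inner I x (c *\<^sub>R y) = c * coord_inner I x y"
  by (metis coord_inner_scaleR_left coord_inner_commute)

lemma continuous_on_coord_inner: "continuous_on S (\<lambda>x. coord_inner I x y)"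
  unfolding coord_inner_def
  by (intro continuous_intros continuous_on_product_then_coordinatewise[OF continuous_on_id])

lemma continuous_on_add_fun:
  fixes f g :: "'b::topological_space \<Rightarrow> 'a \<Rightarrow> real"
  assumes "continuous_on S f" "continuous_on S g"
  shows "continuous_on S (\<lambda>x. f x + g x)"
  unfolding plus_fun_def
  by (intro continuous_on_coordinatewise_then_product continuous_intros
      assms[THEN continuous_on_product_then_coordinatewise])

lemma continuous_on_scaleR_fun:
  fixes f :: "'b::topological_space \<Rightarrow> 'a \<Rightarrow> real"
  assumes "continuous_on S f"
  shows "continuous_on S (\<lambda>x. c *\<^sub>R f x)"
  unfolding scaleR_fun_def
  by (intro continuous_on_coordinatewise_then_product continuous_intros
      assms[THEN continuous_on_product_then_coordinatewise])

text \<open>The Minkowski sum is the image of the compact product \<open>S \<times> T\<close> under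
  addition, which is continuous in the product topology.\<close>

lemma compact_set_plus_fun:
  fixes S T :: "('a \<Rightarrow> real) set"
  assumes "compact S" "compact T"
  shows "compact (S + T)"
proof -
  have "S + T = (\<lambda>z. fst z + snd z) ` (S \<times> T)"
    by (force simp: set_plus_def)
  then show ?thesis
    by (simp only:) (intro compact_continuous_image continuous_on_add_fun continuous_on_fst
        continuous_on_snd continuous_on_id compact_Times assms)
qed

text \<open>Translation by a vector of \<open>coord_space I\<close> maps relatively open sets to
  relatively open sets, so an interior point \<open>u\<close> of \<open>S\<close> yields the
  interior point \<open>u + v\<close> of \<open>T\<close>.\<close>

lemma interior_of_coord_space_translate:
  assumes v: "v \<in> coord_space I"
    and ne: "(top_of_set (coord_space I)) interior_of S \<noteq> {}"
    and sub: "\<And>x. x \<in> S \<Longrightarrow> x + v \<in> T"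
  shows "(top_of_set (coord_space I)) interior_of T \<noteq> {}"
proof -
  obtain u U where U: "openin (top_of_set (coord_space I)) U" "u \<in> U" "U \<subseteq> S"
    using ne by (auto simp: interior_of_def)
  then obtain W where W: "open W" "U = coord_space I \<inter> W"
    by (auto simp: openin_open)
  \<comment> \<open>\<open>W'\<close> is \<open>W\<close> shifted by \<open>v\<close>. The
    subtraction is written as a sum with a constant so that \<open>continuous_on_add_fun\<close>
    applies.\<close>
  define W' where "W' = (\<lambda>x. x + (- 1) *\<^sub>R v) -` W"
  have "open W'"
    unfolding W'_def
    by (intro open_vimage W continuous_on_add_fun continuous_on_id continuous_on_const)
  then have "openin (top_of_set (coord_space I)) (coord_space I \<inter> W')"
    by (auto simp: openin_open)
  moreover have "u + v \<in> coord_space I \<inter> W'"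
    using U W v by (auto simp: W'_def coord_space_add)
  moreover have "coord_space I \<inter> W' \<subseteq> T"
  proof
    fix x assume x: "x \<in> coord_space I \<inter> W'"
    then have "x - v \<in> U"
      using W v by (auto simp: W'_def coord_space_diff)
    then show "x \<in> T"
      using U(3) sub[of "x - v"] by auto
  qed
  ultimately show ?thesis
    unfolding interior_of_def by blast
qed

section \<open>Symmetric convex bodies: Minkowski sums and support points\<close>

lemma sym_bodies_uminus: "P \<in> sym_bodies I \<Longrightarrow> x \<in> P \<Longrightarrow> - x \<in> P"
  unfolding sym_bodies_def by blast

lemma sym_bodies_nonempty: "P \<in> sym_bodies I \<Longrightarrow> P \<noteq> {}"
  unfolding sym_bodies_def by (auto simp: interior_of_def)

lemma sym_bodies_coord_space: "P \<in> sym_bodies I \<Longrightarrow> x \<in> P \<Longrightarrow> x \<in> coord_space I"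
  unfolding sym_bodies_def by blast

text \<open>Serves twice in the theorem: for the new factor at index \<open>j\<close> and for the
  sum in the tensor product.\<close>

lemma sym_bodies_add_scaleR:
  assumes P: "P \<in> sym_bodies I" and R: "R \<in> sym_bodies I"
  shows "P + (*\<^sub>R) t ` R \<in> sym_bodies I"
proof -
  let ?S = "P + (*\<^sub>R) t ` R"
  have mem: "x \<in> ?S \<longleftrightarrow> (\<exists>p\<in>P. \<exists>r\<in>R. x = p + t *\<^sub>R r)" for x
    by (auto simp: set_plus_def)
  have "?S \<subseteq> coord_space I"
    using sym_bodies_coord_space[OF P] sym_bodies_coord_space[OF R]
    by (auto simp: mem coord_space_add coord_space_scaleR)
  moreover have "compact ?S"
    using P R by (intro compact_set_plus_fun compact_continuous_image continuous_on_scaleR_fun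
        continuous_on_id) (auto simp: sym_bodies_def)
  moreover have "convex ?S"
    using P R by (intro convex_set_plus convex_scaling) (auto simp: sym_bodies_def)
  \<comment> \<open>For any \<open>r\<close> in \<open>R\<close>, the sum contains the translate of
    \<open>P\<close> by \<open>t *\<^sub>R r\<close> and so inherits an interior point from
    \<open>P\<close>.\<close>
  moreover obtain r where r: "r \<in> R"
    using sym_bodies_nonempty[OF R] by blast
  have "(top_of_set (coord_space I)) interior_of ?S \<noteq> {}"
  proof (rule interior_of_coord_space_translate)
    show "t *\<^sub>R r \<in> coord_space I"
      by (intro coord_space_scaleR sym_bodies_coord_space[OF R] r)
    show "(top_of_set (coord_space I)) interior_of P \<noteq> {}"
      using P by (simp add: sym_bodies_def)
    show "x + t *\<^sub>R r \<in> ?S" if "x \<in> P" for x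
      using that r by (auto simp: mem)
  qed
  moreover have neg: "- x \<in> ?S" if x: "x \<in> ?S" for x
  proof -
    obtain p r where "p \<in> P" "r \<in> R" "x = p + t *\<^sub>R r"
      using x by (auto simp: mem)
    then have "- p \<in> P" "- r \<in> R" "- x = - p + t *\<^sub>R (- r)"
      using sym_bodies_uminus[OF P] sym_bodies_uminus[OF R] by auto
    then show ?thesis
      unfolding mem by blast
  qed
  have "uminus ` ?S = ?S"
  proof
    show "uminus ` ?S \<subseteq> ?S"
      using neg by blast
    show "?S \<subseteq> uminus ` ?S"
      using neg by (metis (no_types, lifting) add.inverse_inverse image_eqI subsetI)
  qed
  ultimately show ?thesis
    by (simp add: sym_bodies_def)
qed

text \<open>Compactness gives a maximizer \<open>p\<close>. By symmetry \<open>- p\<close> competes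
  as well, with the negated value, so the maximum is nonnegative.\<close>

lemma sym_bodies_support:
  assumes P: "P \<in> sym_bodies I"
  obtains p where "p \<in> P" "0 \<le> coord_inner I p y"
    "\<And>x. x \<in> P \<Longrightarrow> coord_inner I x y \<le> coord_inner I p y"
proof -
  have "compact P"
    using P by (simp add: sym_bodies_def)
  then obtain p where p: "p \<in> P" "\<And>x. x \<in> P \<Longrightarrow> coord_inner I x y \<le> coord_inner I p y"
    using continuous_attains_sup[OF _ sym_bodies_nonempty[OF P] continuous_on_coord_inner] by blast
  have "coord_inner I (- p) y = - coord_inner I p y"
    by (simp add: coord_inner_def fun_Compl_def sum_negf)
  then have "0 \<le> coord_inner I p y"
    using p(2)[OF sym_bodies_uminus[OF P p(1)]] by linarith
  with p that show thesis by blast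
qed

section \<open>Multilinearity of elementary tensors and pairing with the injective product\<close>

lemma prod_fun_upd:
  fixes f :: "'i \<Rightarrow> 'b \<Rightarrow> 'c::comm_monoid_mult"
  assumes "finite A" "j \<in> A"
  shows "(\<Prod>i\<in>A. (f(j := v)) i (m i)) = v (m j) * (\<Prod>i\<in>A - {j}. f i (m i))"
  using assms by (subst prod.remove[of A j]) (auto intro!: prod.cong)

text \<open>By \<open>prod_fun_upd\<close> the argument at \<open>j\<close> enters each coordinate
  through a single factor.\<close>

lemma elem_tensor_add:
  assumes "j \<in> {1..l}"
  shows "elem_tensor l d (x(j := u + v)) = elem_tensor l d (x(j := u)) + elem_tensor l d (x(j := v))"
  unfolding elem_tensor_def prod_fun_upd[OF finite_atLeastAtMost assms]
  by (auto simp: plus_fun_def algebra_simps)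

lemma elem_tensor_scaleR:
  assumes "j \<in> {1..l}"
  shows "elem_tensor l d (x(j := c *\<^sub>R u)) = c *\<^sub>R elem_tensor l d (x(j := u))"
  unfolding elem_tensor_def prod_fun_upd[OF finite_atLeastAtMost assms]
  by (auto simp: scaleR_fun_def)

lemma elem_tensor_mem_proj_tensor:
  "(\<And>i. i \<in> {1..l} \<Longrightarrow> x i \<in> P i) \<Longrightarrow> elem_tensor l d x \<in> proj_tensor l d P"
  unfolding proj_tensor_def by (intro hull_inc) blast

text \<open>The condition \<open>coord_inner I x q \<le> 1\<close> cuts out a convex set of
  \<open>x\<close>, so it passes from generators to their hull.\<close>

lemma mem_polar_convex_hull:
  "q \<in> polar I (convex hull S) \<longleftrightarrow> q \<in> coord_space I \<and> (\<forall>x\<in>S. coord_inner I x q \<le> 1)"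
proof -
  have "convex {x. coord_inner I x q \<le> 1}"
    by (auto simp: convex_def coord_inner_add_left coord_inner_scaleR_left intro: convex_bound_le)
  then have "convex hull S \<subseteq> {x. coord_inner I x q \<le> 1}" if "\<forall>x\<in>S. coord_inner I x q \<le> 1"
    using that by (intro hull_minimal) auto
  then show ?thesis
    using hull_subset[of S convex] by (fastforce simp: polar_def)
qed

text \<open>Rescaling \<open>y j\<close> moves it into the polar of \<open>P j\<close>, where the
  defining bound \<open>1\<close> of \<open>inj_tensor\<close> applies; homogeneity in the argument
  at \<open>j\<close> turns this into the bound \<open>a\<close>.\<close>

lemma inj_tensor_le:
  assumes j: "j \<in> {1..l}" and q: "q \<in> inj_tensor l d P"
    and y: "\<And>i. i \<in> {1..l} - {j} \<Longrightarrow> y i \<in> polar {1..d i} (P i)"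
    and yj: "y j \<in> coord_space {1..d j}"
    and a: "0 \<le> a" "\<And>x. x \<in> P j \<Longrightarrow> coord_inner {1..d j} x (y j) \<le> a"
  shows "coord_inner (multi_indices l d) (elem_tensor l d y) q \<le> a"
proof (rule field_le_epsilon)
  \<comment> \<open>Dividing by \<open>a + e\<close> instead of \<open>a\<close> covers the case \<open>a = 0\<close>.\<close>
  fix e :: real assume e: "e > 0"
  define c where "c = inverse (a + e)"
  have c: "c > 0" "c * (a + e) = 1"
    using a(1) e by (auto simp: c_def)
  have "c *\<^sub>R y j \<in> polar {1..d j} (P j)"
  proof -
    have "c * coord_inner {1..d j} x (y j) \<le> 1" if "x \<in> P j" for x
      using mult_left_mono[of "coord_inner {1..d j} x (y j)" "a + e" c] a(2)[OF that] c e by simp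
    then show ?thesis
      using yj by (simp add: polar_def coord_space_scaleR coord_inner_scaleR_right)
  qed
  then have "elem_tensor l d (y(j := c *\<^sub>R y j)) \<in> proj_tensor l d (\<lambda>i. polar {1..d i} (P i))"
    using y by (intro elem_tensor_mem_proj_tensor) auto
  \<comment> \<open>The left side is the pairing of \<open>q\<close> with the rescaled tensor, hence
    at most \<open>1\<close>, which is written as \<open>c * (a + e)\<close> so that
    \<open>c\<close> cancels.\<close>
  then have "c * coord_inner (multi_indices l d) (elem_tensor l d y) q \<le> c * (a + e)"
    using q by (auto simp: inj_tensor_def polar_def elem_tensor_scaleR[OF j]
        coord_inner_scaleR_left c)
  then show "coord_inner (multi_indices l d) (elem_tensor l d y) q \<le> a + e"
    using c(1) by simp
qed

section \<open>The lower and upper inclusions for the Minkowski sum\<close>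

lemma proj_tensor_add_scaleR_subset:
  assumes j: "j \<in> {1..l}"
    and Q: "proj_tensor l d P \<subseteq> Q" "convex Q"
    and R: "proj_tensor l d (P(j := S)) \<subseteq> R" "convex R"
  shows "proj_tensor l d (P(j := P j + (*\<^sub>R) t ` S)) \<subseteq> Q + (*\<^sub>R) t ` R"
  unfolding proj_tensor_def
\<comment> \<open>The sum is convex, so only the generating tensors need to be checked.\<close>
proof (rule hull_minimal)
  show "convex (Q + (*\<^sub>R) t ` R)"
    by (intro convex_set_plus convex_scaling Q R)
  show "{elem_tensor l d x |x. \<forall>i\<in>{1..l}. x i \<in> (P(j := P j + (*\<^sub>R) t ` S)) i} \<subseteq> Q + (*\<^sub>R) t ` R"
  proof clarify
    fix x assume x: "\<forall>i\<in>{1..l}. x i \<in> (P(j := P j + (*\<^sub>R) t ` S)) i"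
    then have "x j \<in> P j + (*\<^sub>R) t ` S"
      using j by fastforce
    then obtain p s where p: "p \<in> P j" and s: "s \<in> S" and xj: "x j = p + t *\<^sub>R s"
      by (auto simp: set_plus_def)
    have xi: "x i \<in> P i" if "i \<in> {1..l}" "i \<noteq> j" for i
      using x that by (metis fun_upd_apply)
    have "elem_tensor l d (x(j := p)) \<in> Q"
      using Q(1) by (rule subsetD) (use p xi in \<open>auto intro!: elem_tensor_mem_proj_tensor\<close>)
    moreover have "elem_tensor l d (x(j := s)) \<in> R"
      using R(1) by (rule subsetD) (use s xi in \<open>auto intro!: elem_tensor_mem_proj_tensor\<close>)
    moreover have "elem_tensor l d x =
        elem_tensor l d (x(j := p)) + t *\<^sub>R elem_tensor l d (x(j := s))"
      \<comment> \<open>Reading \<open>xj\<close> backwards turns the updated tuple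
        \<open>x(j := p + t *\<^sub>R s)\<close> into \<open>x\<close> itself.\<close>
      using elem_tensor_add[OF j, of d x p "t *\<^sub>R s"]
      by (simp add: elem_tensor_scaleR[OF j] flip: xj)
    ultimately show "elem_tensor l d x \<in> Q + (*\<^sub>R) t ` R"
      by (auto intro: set_plus_intro)
  qed
qed

lemma add_scaleR_subset_inj_tensor:
  assumes j: "j \<in> {1..l}" and t: "t \<ge> 0"
    and Pj: "P j \<in> sym_bodies {1..d j}" and S: "S \<in> sym_bodies {1..d j}"
    and Q: "Q \<subseteq> inj_tensor l d P" and R: "R \<subseteq> inj_tensor l d (P(j := S))"
  shows "Q + (*\<^sub>R) t ` R \<subseteq> inj_tensor l d (P(j := P j + (*\<^sub>R) t ` S))"
proof
  let ?M = "multi_indices l d" and ?P' = "P(j := P j + (*\<^sub>R) t ` S)"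
  fix z assume "z \<in> Q + (*\<^sub>R) t ` R"
  then obtain q r where q: "q \<in> inj_tensor l d P" and r: "r \<in> inj_tensor l d (P(j := S))"
    and z: "z = q + t *\<^sub>R r"
    using Q R by (auto simp: set_plus_def)
  have "z \<in> coord_space ?M"
    using q r unfolding z by (simp add: inj_tensor_def polar_def coord_space_add coord_space_scaleR)
  moreover have "coord_inner ?M (elem_tensor l d y) z \<le> 1"
    if y: "\<forall>i\<in>{1..l}. y i \<in> polar {1..d i} (?P' i)" for y
  proof -
    have yj: "y j \<in> polar {1..d j} (P j + (*\<^sub>R) t ` S)"
      using y j by fastforce
    then have yj': "y j \<in> coord_space {1..d j}"
      by (simp add: polar_def)
    have yi: "y i \<in> polar {1..d i} (P i)" if "i \<in> {1..l}" "i \<noteq> j" for i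
      using y that by (metis fun_upd_apply)
    obtain p where p: "p \<in> P j" "0 \<le> coord_inner {1..d j} p (y j)"
      "\<And>x. x \<in> P j \<Longrightarrow> coord_inner {1..d j} x (y j) \<le> coord_inner {1..d j} p (y j)"
      using sym_bodies_support[OF Pj] by blast
    obtain s where s: "s \<in> S" "0 \<le> coord_inner {1..d j} s (y j)"
      "\<And>x. x \<in> S \<Longrightarrow> coord_inner {1..d j} x (y j) \<le> coord_inner {1..d j} s (y j)"
      using sym_bodies_support[OF S] by blast
    have "coord_inner ?M (elem_tensor l d y) q \<le> coord_inner {1..d j} p (y j)"
      by (rule inj_tensor_le[where y = y, OF j q _ yj']) (use p yi in auto)
    \<comment> \<open>Here the tuple is \<open>P(j := S)\<close>: its entry at \<open>j\<close> is
      \<open>S\<close>, which \<open>s\<close> bounds, and its other entries are those of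
      \<open>P\<close>.\<close>
    moreover have "coord_inner ?M (elem_tensor l d y) r \<le> coord_inner {1..d j} s (y j)"
      by (rule inj_tensor_le[where y = y, OF j r _ yj']) (use s yi in auto)
    ultimately have "coord_inner ?M (elem_tensor l d y) z
        \<le> coord_inner {1..d j} p (y j) + t * coord_inner {1..d j} s (y j)"
      unfolding z coord_inner_add_right coord_inner_scaleR_right
      using t by (intro add_mono mult_left_mono)
    also have "\<dots> = coord_inner {1..d j} (p + t *\<^sub>R s) (y j)"
      by (simp add: coord_inner_add_left coord_inner_scaleR_left)
    \<comment> \<open>Both suprema are attained, so their combination is the value at the single
      point \<open>p + t *\<^sub>R s\<close> of the body whose polar contains
      \<open>y j\<close>.\<close>
    also have "\<dots> \<le> 1"
      using yj p(1) s(1) by (auto simp: polar_def)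
    finally show ?thesis .
  qed
  ultimately show "z \<in> inj_tensor l d ?P'"
    unfolding inj_tensor_def proj_tensor_def mem_polar_convex_hull by blast
qed

theorem proposition4p2:
  fixes l :: nat and d :: "nat \<Rightarrow> nat" and t :: real
    and P :: "nat \<Rightarrow> (nat \<Rightarrow> real) set" and R\<^sub>j :: "(nat \<Rightarrow> real) set" and j :: nat
    and Q R :: "((nat \<Rightarrow> nat) \<Rightarrow> real) set"
  assumes "\<And>i. i \<in> {1..l} \<Longrightarrow> d i \<ge> 2"
    and "t > 0"
    and "\<And>i. i \<in> {1..l} \<Longrightarrow> P i \<in> sym_bodies {1..d i}"
    and "j \<in> {1..l}"
    and "R\<^sub>j \<in> sym_bodies {1..d j}"
    and "Q \<in> bodies_over l d P"
    and "R \<in> bodies_over l d (P(j := R\<^sub>j))"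
  shows "tensorial_body l d (Q + (*\<^sub>R) t ` R) \<and>
    Q + (*\<^sub>R) t ` R \<in> bodies_over l d (P(j := P j + (*\<^sub>R) t ` R\<^sub>j))"
proof -
  let ?P' = "P(j := P j + (*\<^sub>R) t ` R\<^sub>j)"
  have Pj: "P j \<in> sym_bodies {1..d j}"
    using assms(3,4) by blast
  have Q: "Q \<in> sym_bodies (multi_indices l d)" "proj_tensor l d P \<subseteq> Q" "Q \<subseteq> inj_tensor l d P"
    using assms(6) by (auto simp: bodies_over_def)
  have R: "R \<in> sym_bodies (multi_indices l d)" "proj_tensor l d (P(j := R\<^sub>j)) \<subseteq> R"
    "R \<subseteq> inj_tensor l d (P(j := R\<^sub>j))"
    using assms(7) by (auto simp: bodies_over_def)
  have P': "\<forall>i\<in>{1..l}. ?P' i \<in> sym_bodies {1..d i}"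
    using assms(3) sym_bodies_add_scaleR[OF Pj assms(5)] by simp
  moreover have "proj_tensor l d ?P' \<subseteq> Q + (*\<^sub>R) t ` R"
    using proj_tensor_add_scaleR_subset[OF assms(4) Q(2) _ R(2)] Q(1) R(1)
    by (simp add: sym_bodies_def)
  moreover have "Q + (*\<^sub>R) t ` R \<subseteq> inj_tensor l d ?P'"
    using add_scaleR_subset_inj_tensor[where P = P and d = d, OF assms(4) _ Pj assms(5) Q(3) R(3)]
      assms(2) by simp
  ultimately have "Q + (*\<^sub>R) t ` R \<in> bodies_over l d ?P'"
    using sym_bodies_add_scaleR[OF Q(1) R(1)] by (simp add: bodies_over_def)
  \<comment> \<open>The tuple \<open>?P'\<close> is the witness for
    \<open>tensorial_body\<close>.\<close>
  with P' show ?thesis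
    unfolding tensorial_body_def by blast
qed

end
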